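(* Let $(A_1,B_1),\dots,(A_m,B_m)$ be pairs of finite non-empty sets. Write $a_i=|A_i|$ and $b_i=|B_i|$ for $1\le i\le m$. Suppose that (i) $A_i\cap B_i=\emptyset$ for $1\le i\le m$, (ii) $A_i\cap B_j\neq\emptyset$ for $1\le i<j\le m$, and (iii) $a_1\le a_2\le\dots\le a_m$ and $b_1\ge b_2\ge\dots\ge b_m$. Then $$\sum_{i=1}^m \frac{1}{\binom{a_i+b_i}{a_i}}\le 1.$$ *)

theory Defs
  imports Complex_Main
begin

end

theory Submission
  imports Defs "HOL-Library.Multiset" "HOL-Computational_Algebra.Polynomial"
begin

text \<open>
  After an injection of the ground set into the reals, the pairs act on symmetric polynomials.
  A symmetric polynomial in \<open>a\<close> variables, of degree at most \<open>b\<close> in each of them, is regarded as a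
  function of multisets of \<open>a\<close> reals; these functions form a space of dimension
  \<open>(a + b) choose a\<close>. The set \<open>B j\<close> yields the polynomial \<open>\<Prod>y. \<Prod>x\<in>B j. y - x\<close>, which is
  nonzero at \<open>A j\<close>, but vanishes at every multiset that contains some earlier \<open>A i\<close>.

  For a family \<open>\<A>\<close> of sets consider the space of those polynomials that vanish at all multisets
  containing a member of \<open>\<A>\<close>, and let its density be its dimension divided by
  \<open>(a + b) choose a\<close>. The density is at most 1. When \<open>A j\<close> joins the earlier sets while
  \<open>a = card (A j)\<close> and \<open>b = card (B j)\<close>, the polynomial of \<open>B j\<close> is lost, so the density drops
  by at least \<open>1 / ((a + b) choose a)\<close> (\<open>density_insert\<close>). Between two pairs, \<open>a\<close> grows and \<open>b\<close>
  shrinks, and this never increases the density for a fixed family (\<open>density_antimono\<close>). Since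
  the density ends nonnegative, the total of the drops is at most 1.

  The monotonicity of the density is an averaging argument. A polynomial is determined by its
  values at the \<open>a\<close>-subsets of any set \<open>G\<close> of \<open>a + b\<close> reals, so the space has a coordinate basis
  consisting of such subsets. Fixing one variable to \<open>g \<in> G\<close> lowers \<open>a\<close> and involves the basis
  elements that contain \<open>g\<close>; multiplication by \<open>\<Prod>y. y - g\<close> raises \<open>b\<close> and involves those that
  avoid \<open>g\<close>. Each gives a dimension inequality, and counting incidences over all \<open>g \<in> G\<close> turns
  the sum of these inequalities into the required comparison of densities.
\<close>

section \<open>Rank of a space of functions\<close>

definition lin_space :: "('x \<Rightarrow> real) set \<Rightarrow> bool" where
  "lin_space V \<longleftrightarrow> (\<forall>f\<in>V. \<forall>g\<in>V. \<forall>c. (\<lambda>x. f x + c * g x) \<in> V)"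

definition determines :: "'x set \<Rightarrow> ('x \<Rightarrow> real) set \<Rightarrow> bool" where
  "determines D V \<longleftrightarrow> (\<forall>f\<in>V. (\<forall>x\<in>D. f x = 0) \<longrightarrow> (\<forall>x. f x = 0))"

definition independent_points :: "'x set \<Rightarrow> ('x \<Rightarrow> real) set \<Rightarrow> bool" where
  "independent_points E V \<longleftrightarrow>
    (\<exists>F. \<forall>e\<in>E. F e \<in> V \<and> (\<forall>e'\<in>E. F e e' = (if e = e' then 1 else 0)))"

text \<open>
  This is the dimension of \<open>V\<close>, for \<open>V\<close> a linear space determined by finitely many points. It is
  expressed by evaluation points because the averaging arguments count the points that do or do
  not involve a given real.
\<close>
definition rank :: "('x \<Rightarrow> real) set \<Rightarrow> nat" where
  "rank V = (LEAST n. \<exists>D. finite D \<and> determines D V \<and> card D = n)"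

lemma lin_spaceD: "lin_space V \<Longrightarrow> f \<in> V \<Longrightarrow> g \<in> V \<Longrightarrow> (\<lambda>x. f x + c * g x) \<in> V"
  by (auto simp: lin_space_def)

lemma lin_space_scale:
  assumes "lin_space V" "f \<in> V"
  shows "(\<lambda>x. c * f x) \<in> V"
  using lin_spaceD[OF assms(1) assms(2) assms(2), of "c - 1"] by (simp add: algebra_simps)

text \<open>
  Gaussian elimination on the points of \<open>D\<close>: restricting to the functions that vanish at one of
  them costs at most one point of \<open>E\<close>, the pivot \<open>e0\<close>.
\<close>
lemma card_independent_le_card_determining:
  assumes "finite D" "lin_space V" "determines D V" "finite E" "independent_points E V"
  shows "card E \<le> card D"
  using assms
proof (induction D arbitrary: V E rule: finite_induct)
  case empty
  from empty.prems(4) obtain F where F: "\<forall>e\<in>E. F e \<in> V \<and> (\<forall>e'\<in>E. F e e' = (if e = e' then 1 else 0))"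
    unfolding independent_points_def by blast
  have "E = {}"
  proof (rule ccontr)
    assume "E \<noteq> {}"
    then obtain e where "e \<in> E" by blast
    with F have "F e \<in> V" "F e e = 1" by auto
    moreover from \<open>F e \<in> V\<close> have "F e e = 0"
      using empty.prems(2) unfolding determines_def by blast
    ultimately show False by simp
  qed
  then show ?case by simp
next
  case (insert d D)
  define V0 where "V0 = {f \<in> V. f d = 0}"
  have lin: "lin_space V0"
    using insert.prems(1) by (auto simp: V0_def lin_space_def)
  have det: "determines D V0"
    using insert.prems(2) by (auto simp: V0_def determines_def)
  from insert.prems(4) obtain F where F: "\<And>e. e \<in> E \<Longrightarrow> F e \<in> V"
    "\<And>e e'. e \<in> E \<Longrightarrow> e' \<in> E \<Longrightarrow> F e e' = (if e = e' then 1 else 0)"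
    unfolding independent_points_def by blast
  show ?case
  proof (cases "\<exists>e0\<in>E. F e0 d \<noteq> 0")
    case False
    then have "independent_points E V0"
      unfolding independent_points_def using F by (intro exI[of _ F]) (auto simp: V0_def)
    from insert.IH[OF lin det insert.prems(3) this] insert.hyps show ?thesis by simp
  next
    case True
    then obtain e0 where e0: "e0 \<in> E" "F e0 d \<noteq> 0" by blast
    define F' where "F' = (\<lambda>e x. F e x + (- F e d / F e0 d) * F e0 x)"
    have "independent_points (E - {e0}) V0"
      unfolding independent_points_def
    proof (intro exI[of _ F'] ballI conjI)
      fix e assume e: "e \<in> E - {e0}"
      have "F' e \<in> V"
        unfolding F'_def using e e0 F(1) by (intro lin_spaceD[OF insert.prems(1)]) auto
      then show "F' e \<in> V0" using e0 by (simp add: V0_def F'_def)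
      fix e' assume "e' \<in> E - {e0}"
      then show "F' e e' = (if e = e' then 1 else 0)"
        using e e0 F(2)[of e e'] F(2)[of e0 e'] by (auto simp: F'_def)
    qed
    from insert.IH[OF lin det _ this] insert.prems(3) have "card (E - {e0}) \<le> card D" by simp
    then show ?thesis using e0 insert.hyps insert.prems(3) by simp
  qed
qed

lemma rank_le_card: "finite D \<Longrightarrow> determines D V \<Longrightarrow> rank V \<le> card D"
  unfolding rank_def by (rule Least_le) blast

lemma rank_attained:
  assumes "finite D" "determines D V"
  obtains D' where "finite D'" "determines D' V" "card D' = rank V"
proof -
  have "\<exists>D'. finite D' \<and> determines D' V \<and> card D' = rank V"
    unfolding rank_def by (rule LeastI_ex) (use assms in blast)
  then show ?thesis using that by blast
qed

lemma card_independent_le_rank: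
  assumes "lin_space V" "finite D" "determines D V" "finite E" "independent_points E V"
  shows "card E \<le> rank V"
  using assms by (metis rank_attained card_independent_le_card_determining)

text \<open>
  An inclusion-minimal determining subset is automatically independent: omitting \<open>e\<close> admits a
  function that vanishes on the remaining points but not at \<open>e\<close>, and rescaling it gives the dual
  basis.
\<close>
lemma obtain_coordinate_basis:
  assumes V: "lin_space V" and D: "finite D" "determines D V"
  obtains E where "E \<subseteq> D" "determines E V" "independent_points E V" "card E = rank V"
proof -
  define P where "P = (\<lambda>E. E \<subseteq> D \<and> determines E V)"
  have "P D" using D by (simp add: P_def)
  then obtain E where E: "P E" and least: "\<And>E'. P E' \<Longrightarrow> card E \<le> card E'"
    by (metis ex_has_least_nat)
  have fin: "finite E" using E D by (auto simp: P_def intro: finite_subset)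
  have "\<exists>f\<in>V. \<forall>e'\<in>E. f e' = (if e = e' then 1 else 0)" if "e \<in> E" for e
  proof -
    have "\<not> determines (E - {e}) V"
    proof
      assume "determines (E - {e}) V"
      then have "card E \<le> card (E - {e})" using E by (intro least) (auto simp: P_def)
      then show False using that fin by (metis card_Diff1_less not_le)
    qed
    then obtain f x where f: "f \<in> V" "\<forall>x\<in>E - {e}. f x = 0" "f x \<noteq> 0"
      unfolding determines_def by blast
    then have "f e \<noteq> 0" using E unfolding P_def determines_def by blast
    then show ?thesis
      using f lin_space_scale[OF V f(1), of "1 / f e"]
      by (intro bexI[of _ "\<lambda>x. 1 / f e * f x"]) auto
  qed
  then have ind: "independent_points E V"
    unfolding independent_points_def by metis
  have "card E = rank V"
    using rank_le_card[OF fin] card_independent_le_rank[OF V D fin ind] E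
    by (simp add: P_def le_antisym)
  with that E ind show ?thesis by (auto simp: P_def)
qed

lemma lin_space_add_sum:
  assumes "lin_space V" "finite E" "\<And>e. e \<in> E \<Longrightarrow> F e \<in> V" "f \<in> V"
  shows "(\<lambda>x. f x + (\<Sum>e\<in>E. c e * F e x)) \<in> V"
  using assms(2,3)
proof (induction E rule: finite_induct)
  case (insert e E)
  then have "(\<lambda>x. (f x + (\<Sum>e\<in>E. c e * F e x)) + c e * F e x) \<in> V"
    using lin_spaceD[OF assms(1)] by simp
  with insert.hyps show ?case by (simp add: algebra_simps)
qed (use assms(4) in simp)

lemma rank_drop:
  assumes V: "lin_space V" and D: "finite D" "determines D V"
    and f: "f \<in> V" "f x \<noteq> 0"
  shows "Suc (rank {h \<in> V. h x = 0}) \<le> rank V"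
proof -
  define V0 where "V0 = {h \<in> V. h x = 0}"
  have "lin_space V0" using V by (auto simp: V0_def lin_space_def)
  moreover have "determines D V0" using D(2) unfolding V0_def determines_def by blast
  ultimately obtain E where E: "E \<subseteq> D" "determines E V0" "independent_points E V0"
      "card E = rank V0"
    using obtain_coordinate_basis[OF _ D(1)] by metis
  then have fin: "finite E" using D(1) finite_subset by blast
  obtain F where F: "\<And>e. e \<in> E \<Longrightarrow> F e \<in> V" "\<And>e. e \<in> E \<Longrightarrow> F e x = 0"
    "\<And>e e'. e \<in> E \<Longrightarrow> e' \<in> E \<Longrightarrow> F e e' = (if e = e' then 1 else 0)"
    using E(3) unfolding independent_points_def V0_def by blast
  have "x \<notin> E" using F(2)[of x] F(3)[of x x] by auto
  \<comment> \<open>Subtracting the interpolant of f on E leaves a function that vanishes on E but not at x.\<close>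
  define f' where "f' = (\<lambda>y. f y + (\<Sum>e\<in>E. - f e * F e y))"
  have "f' \<in> V" unfolding f'_def by (rule lin_space_add_sum[OF V fin F(1) f(1)])
  have "f' e = 0" if "e \<in> E" for e
  proof -
    have "(\<Sum>e'\<in>E. - f e' * F e' e) = (\<Sum>e'\<in>E. if e' = e then - f e' else 0)"
      by (rule sum.cong) (use that F(3) in auto)
    then show ?thesis using that fin by (simp add: f'_def)
  qed
  moreover have "f' x = f x" by (simp add: f'_def F(2))
  ultimately have "independent_points (insert x E) V"
    unfolding independent_points_def
    using F \<open>x \<notin> E\<close> f(2) lin_space_scale[OF V \<open>f' \<in> V\<close>, of "1 / f x"]
    by (intro exI[of _ "\<lambda>e. if e = x then (\<lambda>y. 1 / f x * f' y) else F e"]) auto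
  then have "card (insert x E) \<le> rank V"
    using card_independent_le_rank[OF V D] fin by blast
  then show ?thesis using \<open>x \<notin> E\<close> fin E(4) by (simp add: V0_def)
qed

section \<open>Symmetric polynomials as functions of multisets\<close>

text \<open>
  Symmetric polynomials in \<open>a\<close> variables of degree at most \<open>b\<close> in each. Symmetry comes from the
  multiset argument, and polynomiality is asked only in one variable while the others are held
  fixed. Being zero off the multisets of size \<open>a\<close> makes functions that agree at size \<open>a\<close> equal.
\<close>
definition sym_poly :: "nat \<Rightarrow> nat \<Rightarrow> (real multiset \<Rightarrow> real) set" where
  "sym_poly a b = {f. (\<forall>M. size M \<noteq> a \<longrightarrow> f M = 0) \<and>
     (\<forall>M. \<exists>p. degree p \<le> b \<and> (\<forall>y. f (add_mset y M) = poly p y))}"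

definition vanishing :: "real set set \<Rightarrow> nat \<Rightarrow> nat \<Rightarrow> (real multiset \<Rightarrow> real) set" where
  "vanishing \<A> a b = {f \<in> sym_poly a b. \<forall>X\<in>\<A>. \<forall>M. mset_set X \<subseteq># M \<longrightarrow> f M = 0}"

definition grid :: "real set \<Rightarrow> nat \<Rightarrow> real multiset set" where
  "grid G a = mset_set ` {S. S \<subseteq> G \<and> card S = a}"

lemma lin_space_vanishing: "lin_space (vanishing \<A> a b)"
proof -
  have "\<exists>r. degree r \<le> b \<and> (\<forall>y. f (add_mset y M) + c * g (add_mset y M) = poly r y)"
    if "f \<in> vanishing \<A> a b" "g \<in> vanishing \<A> a b" for f g c M
  proof -
    obtain p q where "degree p \<le> b" "\<forall>y. f (add_mset y M) = poly p y"
      "degree q \<le> b" "\<forall>y. g (add_mset y M) = poly q y"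
      using \<open>f \<in> _\<close> \<open>g \<in> _\<close> unfolding vanishing_def sym_poly_def by blast
    then show ?thesis
      by (intro exI[of _ "p + smult c q"]) (auto intro: degree_add_le order_trans[OF degree_smult_le])
  qed
  then show ?thesis unfolding lin_space_def by (auto simp: vanishing_def sym_poly_def)
qed

lemma card_set_mset_le_size: "card (set_mset M) \<le> size M"
  by (induction M) (auto simp: card_insert_if)

text \<open>
  Induction on the number of entries of \<open>M\<close> that are outside \<open>G\<close> or repeated. If such an entry
  \<open>y\<close> is replaced by an unused point of \<open>G\<close>, the value is 0 by induction; the unused points are
  more than \<open>b\<close> zeros of the one-variable polynomial in that entry, which therefore vanishes at
  \<open>y\<close> too.
\<close>
lemma sym_poly_zero_if_zero_on_grid:
  assumes f: "f \<in> sym_poly a b" and G: "finite G" "a + b \<le> card G"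
    and zero: "\<And>N. N \<in> grid G a \<Longrightarrow> f N = 0"
  shows "f M = 0"
proof (induction "size M - card (set_mset M \<inter> G)" arbitrary: M rule: less_induct)
  case less
  consider "size M \<noteq> a" | "size M = a" "M = mset_set (set_mset M)" "set_mset M \<subseteq> G"
    | y N where "size M = a" "M = add_mset y N" "y \<notin> G - set_mset N"
  proof (cases "set_mset M \<subseteq> G \<and> (\<forall>y. count M y \<le> 1)")
    case True
    then have "count M y = count (mset_set (set_mset M)) y" for y
      by (cases "y \<in># M") (auto simp: le_antisym Suc_le_eq not_in_iff)
    then have "M = mset_set (set_mset M)" by (rule multiset_eqI)
    with True that show ?thesis by blast
  next
    case False
    then obtain y where y: "y \<in># M" "y \<notin> G \<or> count M y > 1"
      by (meson subsetI not_le count_greater_zero_iff less_trans zero_less_one)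
    then obtain N where N: "M = add_mset y N" by (metis multi_member_split)
    with y have "y \<notin> G - set_mset N" by (auto simp: count_greater_zero_iff)
    with N that show ?thesis by blast
  qed
  then show ?case
  proof cases
    case 1
    then show ?thesis using f by (simp add: sym_poly_def)
  next
    case 2
    then have "card (set_mset M) = a" by (metis size_mset_set)
    with 2 have "M \<in> grid G a" unfolding grid_def by blast
    then show ?thesis by (rule zero)
  next
    case (3 y N)
    have rep: "set_mset M \<inter> G = set_mset N \<inter> G" using 3 by auto
    have cN: "card (set_mset N \<inter> G) \<le> size N"
      by (rule order_trans[OF card_mono card_set_mset_le_size]) auto
    obtain p where p: "degree p \<le> b" "\<And>z. f (add_mset z N) = poly p z"
      using f unfolding sym_poly_def by blast
    have root: "poly p g = 0" if g: "g \<in> G - set_mset N" for g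
    proof -
      have "set_mset (add_mset g N) \<inter> G = insert g (set_mset N \<inter> G)" using g by auto
      then have "card (set_mset (add_mset g N) \<inter> G) = Suc (card (set_mset N \<inter> G))"
        using g by simp
      then have "f (add_mset g N) = 0"
        using cN rep 3 by (intro less) simp
      then show ?thesis by (simp add: p)
    qed
    \<comment> \<open>N has a - 1 entries, so at least b + 1 grid points remain as zeros of p.\<close>
    have "b < card (G - set_mset N)"
    proof -
      have "card G - card (set_mset N \<inter> G) = card (G - set_mset N)"
        by (metis card_Diff_subset_Int G(1) finite_Int inf_commute)
      then show ?thesis using cN 3 G(2) by simp
    qed
    have "p = 0"
    proof (rule ccontr)
      assume "p \<noteq> 0"
      then have "card (G - set_mset N) \<le> card {x. poly p x = 0}"
        using root by (intro card_mono poly_roots_finite) auto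
      also have "\<dots> \<le> degree p" using \<open>p \<noteq> 0\<close> by (rule card_poly_roots_bound)
      finally show False using p(1) \<open>b < _\<close> by simp
    qed
    then show ?thesis using p(2) 3 by simp
  qed
qed

lemma finite_grid: "finite G \<Longrightarrow> finite (grid G a)"
  by (simp add: grid_def)

lemma card_grid:
  assumes "finite G"
  shows "card (grid G a) = card G choose a"
proof -
  have "inj_on mset_set {S. S \<subseteq> G \<and> card S = a}"
    by (rule inj_onI) (metis (mono_tags, lifting) assms finite_set_mset_mset_set mem_Collect_eq finite_subset)
  then show ?thesis by (simp add: grid_def card_image n_subsets assms)
qed

lemma grid_memberD:
  assumes "finite G" "M \<in> grid G a"
  shows "set_mset M \<subseteq> G" "card (set_mset M) = a"
  using assms by (auto simp: grid_def finite_subset)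

lemma grid_determines_vanishing:
  assumes "finite G" "a + b \<le> card G"
  shows "determines (grid G a) (vanishing \<A> a b)"
  using sym_poly_zero_if_zero_on_grid[OF _ assms] by (auto simp: determines_def vanishing_def)

lemma obtain_grid: obtains G :: "real set" where "finite G" "card G = n"
  using infinite_arbitrarily_large[OF infinite_UNIV_char_0] by blast

lemma sum_card_filter_member:
  assumes "finite G" "finite E" "\<And>M. M \<in> E \<Longrightarrow> card {g \<in> G. R g M} = k"
  shows "(\<Sum>g\<in>G. card {M \<in> E. R g M}) = k * card E"
proof -
  have "(\<Sum>g\<in>G. card {M \<in> E. R g M}) = (\<Sum>M\<in>E. card {g \<in> G. R g M})"
    using sum.swap_restrict[OF assms(1,2), of "\<lambda>_ _. 1::nat" R] by simp
  then show ?thesis using assms(3) by simp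
qed

section \<open>Density of the vanishing space\<close>

lemma prod_mset_diff_eq_0_iff: "(\<Prod>y\<in>#M. y - g) = 0 \<longleftrightarrow> g \<in># M" for g :: real
  by (induction M) auto

lemma vanishing_mult_linear:
  assumes "f \<in> vanishing \<A> a b"
  shows "(\<lambda>M. f M * (\<Prod>y\<in>#M. y - g)) \<in> vanishing \<A> a (Suc b)"
proof -
  have "\<exists>q. degree q \<le> Suc b \<and>
      (\<forall>y. f (add_mset y M) * (\<Prod>y\<in>#add_mset y M. y - g) = poly q y)" for M
  proof -
    obtain p where p: "degree p \<le> b" "\<forall>y. f (add_mset y M) = poly p y"
      using assms unfolding vanishing_def sym_poly_def by blast
    have "degree (p * [:- g, 1:]) \<le> Suc b"
      using degree_mult_le[of p "[:- g, 1:]"] p(1) by simp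
    then have "degree (smult (\<Prod>y\<in>#M. y - g) (p * [:- g, 1:])) \<le> Suc b"
      using degree_smult_le order_trans by blast
    then show ?thesis using p(2)
      by (intro exI[of _ "smult (\<Prod>y\<in>#M. y - g) (p * [:- g, 1:])"]) (simp add: algebra_simps)
  qed
  then show ?thesis using assms by (simp add: vanishing_def sym_poly_def)
qed

lemma vanishing_fix_variable:
  assumes "f \<in> vanishing \<A> (Suc a) b"
  shows "(\<lambda>M. f (add_mset g M)) \<in> vanishing \<A> a b"
proof -
  have "\<exists>p. degree p \<le> b \<and> (\<forall>y. f (add_mset g (add_mset y M)) = poly p y)" for M
  proof -
    obtain p where "degree p \<le> b" "\<forall>y. f (add_mset y (add_mset g M)) = poly p y"
      using assms unfolding vanishing_def sym_poly_def by blast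
    then show ?thesis by (metis add_mset_commute)
  qed
  moreover have "mset_set X \<subseteq># add_mset g M" if "mset_set X \<subseteq># M" for X M
    using that by (metis add_mset_add_single mset_subset_eq_add_left subset_mset.order_trans)
  ultimately show ?thesis using assms by (auto simp: vanishing_def sym_poly_def)
qed

text \<open>
  Take a coordinate basis \<open>E\<close> of the larger space. If \<open>f\<close> vanishes at the members of \<open>E\<close> avoiding
  \<open>g\<close>, then \<open>f M * (\<Prod>y\<in>#M. y - g)\<close> vanishes on all of \<open>E\<close>, hence everywhere, so \<open>f\<close> is zero at
  all multisets avoiding \<open>g\<close> and thus zero. The smaller rank is therefore at most the number of
  members of \<open>E\<close> that avoid \<open>g\<close>. Each member avoids \<open>b + 1\<close> points of \<open>G\<close>, and summing over \<open>g\<close>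
  gives the bound.
\<close>
lemma rank_vanishing_degree_step:
  "(a + Suc b) * rank (vanishing \<A> a b) \<le> Suc b * rank (vanishing \<A> a (Suc b))"
proof -
  obtain G :: "real set" where G: "finite G" "card G = a + Suc b" by (rule obtain_grid)
  have det: "determines (grid G a) (vanishing \<A> a (Suc b))"
    using G by (intro grid_determines_vanishing) auto
  obtain E where E: "E \<subseteq> grid G a" "determines E (vanishing \<A> a (Suc b))"
      "card E = rank (vanishing \<A> a (Suc b))"
    by (rule obtain_coordinate_basis[OF lin_space_vanishing finite_grid[OF G(1)] det])
  have fin: "finite E" using E(1) finite_grid[OF G(1)] finite_subset by blast
  have "rank (vanishing \<A> a b) \<le> card {M \<in> E. g \<notin># M}" if g: "g \<in> G" for g
  proof (rule rank_le_card)
    show "determines {M \<in> E. g \<notin># M} (vanishing \<A> a b)"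
      unfolding determines_def
    proof (intro ballI impI allI)
      fix f M assume f: "f \<in> vanishing \<A> a b" and f0: "\<forall>M\<in>{M \<in> E. g \<notin># M}. f M = 0"
      have "\<forall>M\<in>E. f M * (\<Prod>y\<in>#M. y - g) = 0"
        unfolding mult_eq_0_iff prod_mset_diff_eq_0_iff using f0 by blast
      then have zero: "f M * (\<Prod>y\<in>#M. y - g) = 0" for M
        using E(2)[unfolded determines_def, rule_format, OF vanishing_mult_linear[OF f, of g]] by simp
      \<comment> \<open>Without g there remain a + b points, still enough to determine f.\<close>
      have zero_off_g: "f N = 0" if "N \<in> grid (G - {g}) a" for N
        using zero[of N] grid_memberD(1)[OF _ that] G(1)
        unfolding mult_eq_0_iff prod_mset_diff_eq_0_iff by blast
      show "f M = 0"
      proof (rule sym_poly_zero_if_zero_on_grid)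
        show "f \<in> sym_poly a b" using f by (simp add: vanishing_def)
        show "finite (G - {g})" "a + b \<le> card (G - {g})" using G g by simp_all
      qed (rule zero_off_g)
    qed
  qed (use fin in simp)
  then have "(\<Sum>g\<in>G. rank (vanishing \<A> a b)) \<le> (\<Sum>g\<in>G. card {M \<in> E. g \<notin># M})"
    by (rule sum_mono)
  also have "\<dots> = Suc b * card E"
  proof (rule sum_card_filter_member[OF G(1) fin])
    fix M assume "M \<in> E"
    then have M: "set_mset M \<subseteq> G" "card (set_mset M) = a"
      using grid_memberD[OF G(1)] E(1) by blast+
    have "{g \<in> G. g \<notin># M} = G - set_mset M" by auto
    then show "card {g \<in> G. g \<notin># M} = Suc b" using M G by (simp add: card_Diff_subset)
  qed
  finally show ?thesis using G(2) E(3) by simp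
qed

text \<open>
  Take a coordinate basis \<open>E\<close> of the space in \<open>a + 1\<close> variables. Fixing one variable to \<open>g\<close> turns
  the dual functions of the members containing \<open>g\<close> into dual functions for those members with \<open>g\<close>
  removed, so at most as many members contain \<open>g\<close> as the rank in \<open>a\<close> variables. Each member
  contains \<open>a + 1\<close> points of \<open>G\<close>, and summing over \<open>g\<close> gives the bound.
\<close>
lemma rank_vanishing_variable_step:
  "Suc a * rank (vanishing \<A> (Suc a) b) \<le> Suc (a + b) * rank (vanishing \<A> a b)"
proof -
  obtain G :: "real set" where G: "finite G" "card G = Suc (a + b)" by (rule obtain_grid)
  have det: "determines (grid G (Suc a)) (vanishing \<A> (Suc a) b)"
    using G by (intro grid_determines_vanishing) auto
  obtain E where E: "E \<subseteq> grid G (Suc a)" "independent_points E (vanishing \<A> (Suc a) b)"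
      "card E = rank (vanishing \<A> (Suc a) b)"
    by (rule obtain_coordinate_basis[OF lin_space_vanishing finite_grid[OF G(1)] det])
  have fin: "finite E" using E(1) finite_grid[OF G(1)] finite_subset by blast
  obtain F where F: "\<And>e. e \<in> E \<Longrightarrow> F e \<in> vanishing \<A> (Suc a) b"
    "\<And>e e'. e \<in> E \<Longrightarrow> e' \<in> E \<Longrightarrow> F e e' = (if e = e' then 1 else 0)"
    using E(2) unfolding independent_points_def by blast
  have bound: "card {M \<in> E. g \<in># M} \<le> rank (vanishing \<A> a b)" for g
  proof -
    define E' where "E' = {N. add_mset g N \<in> E}"
    have img: "{M \<in> E. g \<in># M} = add_mset g ` E'"
      by (auto simp: E'_def dest!: multi_member_split)
    have "finite E'"
      by (rule finite_imageD[of "add_mset g"]) (use fin img[symmetric] in \<open>auto simp: inj_on_def\<close>)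
    have "independent_points E' (vanishing \<A> a b)"
      unfolding independent_points_def
      by (intro exI[of _ "\<lambda>N M. F (add_mset g N) (add_mset g M)"])
        (auto simp: E'_def F vanishing_fix_variable)
    then have "card E' \<le> rank (vanishing \<A> a b)"
      using card_independent_le_rank[OF lin_space_vanishing finite_grid[OF G(1)] grid_determines_vanishing]
        G \<open>finite E'\<close> by simp
    moreover have "card {M \<in> E. g \<in># M} = card E'"
      unfolding img by (rule card_image) (simp add: inj_on_def)
    ultimately show ?thesis by simp
  qed
  have "Suc a * card E = (\<Sum>g\<in>G. card {M \<in> E. g \<in># M})"
  proof (rule sum_card_filter_member[OF G(1) fin, symmetric])
    fix M assume "M \<in> E"
    then have M: "set_mset M \<subseteq> G" "card (set_mset M) = Suc a"
      using grid_memberD[OF G(1)] E(1) by blast+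
    have "{g \<in> G. g \<in># M} = set_mset M" using M(1) by auto
    then show "card {g \<in> G. g \<in># M} = Suc a" using M by simp
  qed
  also have "\<dots> \<le> (\<Sum>g\<in>G. rank (vanishing \<A> a b))" by (rule sum_mono) (rule bound)
  finally show ?thesis using G(2) E(3) by simp
qed

definition density :: "real set set \<Rightarrow> nat \<Rightarrow> nat \<Rightarrow> real" where
  "density \<A> a b = rank (vanishing \<A> a b) / ((a + b) choose a)"

lemma density_le_1: "density \<A> a b \<le> 1"
proof -
  obtain G :: "real set" where G: "finite G" "card G = a + b" by (rule obtain_grid)
  have "rank (vanishing \<A> a b) \<le> card (grid G a)"
    using G by (intro rank_le_card finite_grid grid_determines_vanishing) auto
  then have "rank (vanishing \<A> a b) \<le> (a + b) choose a" by (simp add: card_grid G)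
  then show ?thesis by (simp add: density_def divide_le_eq_1)
qed

lemma density_degree_step: "density \<A> a b \<le> density \<A> a (Suc b)"
proof -
  define r s c d where "r = real (rank (vanishing \<A> a b))" and "s = real (rank (vanishing \<A> a (Suc b)))"
    and "c = real ((a + b) choose a)" and "d = real ((a + Suc b) choose a)"
  have "(a + Suc b) choose a = (Suc (a + b)) choose (Suc b)"
    using binomial_symmetric[of a "a + Suc b"] by simp
  moreover have "(a + b) choose a = (a + b) choose b"
    using binomial_symmetric[of a "a + b"] by simp
  ultimately have "Suc b * ((a + Suc b) choose a) = (a + Suc b) * ((a + b) choose a)"
    using Suc_times_binomial_eq[of "a + b" b] by (simp add: mult.commute)
  then have cd: "real (Suc b) * d = real (a + Suc b) * c"
    unfolding c_def d_def by (metis of_nat_mult)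
  have rs: "real (a + Suc b) * r \<le> real (Suc b) * s"
    using rank_vanishing_degree_step[of a b \<A>] unfolding r_def s_def by (metis of_nat_mult of_nat_le_iff)
  have pos: "c > 0" "d > 0" by (simp_all add: c_def d_def)
  have "real (Suc b) * (r * d) = (real (a + Suc b) * r) * c" using cd by algebra
  also have "\<dots> \<le> (real (Suc b) * s) * c" using rs pos by (intro mult_right_mono) auto
  finally have "real (Suc b) * (r * d) \<le> real (Suc b) * (s * c)" by (simp only: mult.assoc)
  then have "r * d \<le> s * c" by (rule mult_left_le_imp_le) simp
  then have "r / c \<le> s / d" using pos by (simp add: field_simps)
  then show ?thesis by (simp only: density_def r_def s_def c_def d_def)
qed

lemma density_variable_step: "density \<A> (Suc a) b \<le> density \<A> a b"
proof -
  define r s c d where "r = real (rank (vanishing \<A> (Suc a) b))" and "s = real (rank (vanishing \<A> a b))"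
    and "c = real ((Suc a + b) choose Suc a)" and "d = real ((a + b) choose a)"
  have "Suc a * ((Suc a + b) choose Suc a) = Suc (a + b) * ((a + b) choose a)"
    using Suc_times_binomial_eq[of "a + b" a] unfolding add_Suc by (simp only: mult.commute)
  then have cd: "real (Suc a) * c = real (Suc (a + b)) * d"
    unfolding c_def d_def by (metis of_nat_mult)
  have rs: "real (Suc a) * r \<le> real (Suc (a + b)) * s"
    using rank_vanishing_variable_step[of a \<A> b] unfolding r_def s_def by (metis of_nat_mult of_nat_le_iff)
  have pos: "c > 0" "d > 0" unfolding c_def d_def of_nat_0_less_iff by (auto intro: zero_less_binomial)
  have "real (Suc a) * (r * d) = (real (Suc a) * r) * d" by (simp only: mult.assoc)
  also have "\<dots> \<le> (real (Suc (a + b)) * s) * d" using rs pos by (intro mult_right_mono) auto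
  also have "\<dots> = real (Suc a) * (s * c)" using cd by algebra
  finally have "r * d \<le> s * c" by (rule mult_left_le_imp_le) simp
  then have "r / c \<le> s / d" using pos by (simp add: field_simps)
  then show ?thesis by (simp only: density_def r_def s_def c_def d_def)
qed

lemma density_antimono:
  assumes "a \<le> a'" "b' \<le> b"
  shows "density \<A> a' b' \<le> density \<A> a b"
proof -
  have "density \<A> a' b' \<le> density \<A> a b'"
    by (rule lift_Suc_antimono_le[where f = "\<lambda>a. density \<A> a b'"])
      (rule density_variable_step, rule assms(1))
  also have "\<dots> \<le> density \<A> a b"
    by (rule lift_Suc_mono_le[where f = "density \<A> a"])
      (rule density_degree_step, rule assms(2))
  finally show ?thesis .
qed

section \<open>The set-pair inequality\<close>

text \<open>
  For \<open>M\<close> the \<open>a\<close> roots of one monic polynomial and \<open>Y\<close> the simple roots of another, this is their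
  resultant; it vanishes exactly when they share a root, which is how it detects intersecting sets.
\<close>
definition resultant :: "nat \<Rightarrow> real set \<Rightarrow> real multiset \<Rightarrow> real" where
  "resultant a Y M = (if size M = a then \<Prod>y\<in>#M. \<Prod>x\<in>Y. y - x else 0)"

lemma resultant_eq_0_iff:
  assumes "finite Y" "size M = a"
  shows "resultant a Y M = 0 \<longleftrightarrow> set_mset M \<inter> Y \<noteq> {}"
proof -
  have "(\<Prod>y\<in>#M. \<Prod>x\<in>Y. y - x) = 0 \<longleftrightarrow> set_mset M \<inter> Y \<noteq> {}"
    using assms(1) by (induction M) auto
  then show ?thesis using assms(2) by (simp add: resultant_def)
qed

lemma resultant_in_vanishing:
  assumes Y: "finite Y" and meet: "\<And>X. X \<in> \<A> \<Longrightarrow> finite X \<and> X \<inter> Y \<noteq> {}"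
  shows "resultant a Y \<in> vanishing \<A> a (card Y)"
proof -
  have "\<exists>p. degree p \<le> card Y \<and> (\<forall>y. resultant a Y (add_mset y M) = poly p y)" for M
  proof (cases "Suc (size M) = a")
    case True
    define p where "p = smult (\<Prod>y\<in>#M. \<Prod>x\<in>Y. y - x) (\<Prod>x\<in>Y. [:- x, 1:])"
    have "degree (\<Prod>x\<in>Y. [:- x, 1:]) = card Y"
      by (simp add: degree_prod_eq_sum_degree)
    then have "degree p \<le> card Y" unfolding p_def by (metis degree_smult_le)
    moreover have "resultant a Y (add_mset y M) = poly p y" for y
      using True by (simp add: resultant_def p_def poly_prod mult.commute)
    ultimately show ?thesis by blast
  next
    case False
    then show ?thesis by (intro exI[of _ 0]) (simp add: resultant_def)
  qed
  moreover have "resultant a Y M = 0" if "X \<in> \<A>" "mset_set X \<subseteq># M" for X M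
  proof (cases "size M = a")
    case True
    have "X \<subseteq> set_mset M" using set_mset_mono[OF that(2)] meet[OF that(1)] by simp
    then show ?thesis using resultant_eq_0_iff[OF Y True] meet[OF that(1)] by blast
  qed (simp add: resultant_def)
  ultimately show ?thesis by (auto simp: vanishing_def sym_poly_def resultant_def)
qed

text \<open>
  At \<open>a = card X\<close> the only multiset of size \<open>a\<close> containing \<open>X\<close> is \<open>X\<close> itself, so adding \<open>X\<close> to
  the family imposes a single linear condition. The resultant with \<open>Y\<close> satisfies the old
  conditions but violates the new one, so the rank drops.
\<close>
lemma density_insert:
  assumes X: "finite X" and Y: "finite Y" and disj: "X \<inter> Y = {}"
    and meet: "\<And>X'. X' \<in> \<A> \<Longrightarrow> finite X' \<and> X' \<inter> Y \<noteq> {}"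
  shows "1 / ((card X + card Y) choose card X) + density (insert X \<A>) (card X) (card Y)
    \<le> density \<A> (card X) (card Y)"
proof -
  define a b where "a = card X" and "b = card Y"
  define V where "V = vanishing \<A> a b"
  obtain G :: "real set" where G: "finite G" "card G = a + b" by (rule obtain_grid)
  have "{h \<in> V. h (mset_set X) = 0} = vanishing (insert X \<A>) a b"
  proof (intro equalityI subsetI)
    fix h assume h: "h \<in> {h \<in> V. h (mset_set X) = 0}"
    have "h M = 0" if "mset_set X \<subseteq># M" for M
    proof (cases "size M = a")
      case True
      then have "M = mset_set X"
        using that by (metis a_def mset_subset_size nless_le size_mset_set subset_mset.le_imp_less_or_eq)
      then show ?thesis using h by simp
    qed (use h in \<open>simp add: V_def vanishing_def sym_poly_def\<close>)
    with h show "h \<in> vanishing (insert X \<A>) a b" by (auto simp: V_def vanishing_def)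
  qed (auto simp: V_def vanishing_def)
  moreover have "resultant a Y \<in> V"
    unfolding V_def b_def by (rule resultant_in_vanishing[OF Y meet])
  moreover have "resultant a Y (mset_set X) \<noteq> 0"
    using resultant_eq_0_iff[OF Y, of "mset_set X" a] X disj by (simp add: a_def)
  moreover have "determines (grid G a) V"
    unfolding V_def using G by (intro grid_determines_vanishing) auto
  ultimately have "Suc (rank (vanishing (insert X \<A>) a b)) \<le> rank V"
    using rank_drop[of V "grid G a" "resultant a Y" "mset_set X"] lin_space_vanishing finite_grid[OF G(1)]
    by (simp add: V_def)
  then have "1 + real (rank (vanishing (insert X \<A>) a b)) \<le> rank (vanishing \<A> a b)"
    by (simp add: V_def)
  then show ?thesis
    unfolding density_def a_def[symmetric] b_def[symmetric] add_divide_distrib[symmetric]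
    by (rule divide_right_mono) simp
qed

text \<open>
  Induction on the number of pairs with the current density added to the sum, so that the
  quantity to be bounded by 1 never increases. Moving from the sizes of one pair to those of the
  next costs nothing by monotonicity, and the new pair is paid for by the drop in density.
\<close>
lemma skew_set_pairs_real:
  fixes A B :: "nat \<Rightarrow> real set"
  assumes fin: "\<And>i. i \<in> {1..m} \<Longrightarrow> finite (A i) \<and> finite (B i)"
    and disj: "\<And>i. i \<in> {1..m} \<Longrightarrow> A i \<inter> B i = {}"
    and cross: "\<And>i j. 1 \<le> i \<Longrightarrow> i < j \<Longrightarrow> j \<le> m \<Longrightarrow> A i \<inter> B j \<noteq> {}"
    and inc: "mono_on {1..m} (\<lambda>i. card (A i))"
    and dec: "antimono_on {1..m} (\<lambda>i. card (B i))"
  shows "(\<Sum>i=1..m. 1 / real ((card (A i) + card (B i)) choose card (A i))) \<le> 1"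
proof -
  define w where "w i = 1 / real ((card (A i) + card (B i)) choose card (A i))" for i
  have step: "w (Suc k) + density (A ` {1..Suc k}) (card (A (Suc k))) (card (B (Suc k)))
      \<le> density (A ` {1..k}) (card (A (Suc k))) (card (B (Suc k)))" if "Suc k \<le> m" for k
  proof -
    have "A ` {1..Suc k} = insert (A (Suc k)) (A ` {1..k})"
      by (simp add: atLeastAtMostSuc_conv)
    then show ?thesis
      using that fin disj[of "Suc k"] cross[of _ "Suc k"] unfolding w_def
      by (simp only:) (rule density_insert; auto)
  qed
  have "(\<Sum>i=1..k. w i) + density (A ` {1..k}) (card (A k)) (card (B k)) \<le> 1"
    if "1 \<le> k" "k \<le> m" for k
    using that
  proof (induction k rule: nat_induct_at_least)
    case base
    show ?case using step[of 0] density_le_1[of "{}" "card (A 1)" "card (B 1)"] base by simp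
  next
    case (Suc k)
    have "density (A ` {1..k}) (card (A (Suc k))) (card (B (Suc k)))
        \<le> density (A ` {1..k}) (card (A k)) (card (B k))"
      using Suc.hyps Suc.prems by (intro density_antimono monotone_onD[OF inc] monotone_onD[OF dec]) auto
    with Suc.IH Suc.prems step[OF Suc.prems] show ?case by simp
  qed
  from this[of m] have "m \<ge> 1 \<Longrightarrow> (\<Sum>i=1..m. w i) \<le> 1"
    by (smt (verit) density_def divide_nonneg_nonneg of_nat_0_le_iff order_refl)
  then show ?thesis unfolding w_def by (cases "m = 0") auto
qed

theorem corollary4p6:
  fixes m :: nat and A B :: "nat \<Rightarrow> 'a set"
  assumes finite_nonempty:
      "\<And>i. i \<in> {1..m} \<Longrightarrow> finite (A i) \<and> A i \<noteq> {} \<and> finite (B i) \<and> B i \<noteq> {}"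
    and disjoint: "\<And>i. i \<in> {1..m} \<Longrightarrow> A i \<inter> B i = {}"
    and crossing: "\<And>i j. 1 \<le> i \<Longrightarrow> i < j \<Longrightarrow> j \<le> m \<Longrightarrow> A i \<inter> B j \<noteq> {}"
    and card_A_increasing: "mono_on {1..m} (\<lambda>i. card (A i))"
    and card_B_decreasing: "antimono_on {1..m} (\<lambda>i. card (B i))"
  shows "(\<Sum>i=1..m. 1 / real ((card (A i) + card (B i)) choose card (A i))) \<le> 1"
proof -
  define U where "U = (\<Union>i\<in>{1..m}. A i \<union> B i)"
  have "finite U" using finite_nonempty by (auto simp: U_def)
  then obtain h :: "'a \<Rightarrow> nat" where "inj_on h U"
    using finite_imp_inj_to_nat_seg by blast
  define \<phi> where "\<phi> = real \<circ> h"
  have inj: "inj_on \<phi> U"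
    unfolding \<phi>_def using \<open>inj_on h U\<close> by (intro comp_inj_on) (auto simp: inj_on_def)
  have sub: "A i \<subseteq> U" "B i \<subseteq> U" if "i \<in> {1..m}" for i
    using that by (auto simp: U_def)
  have card: "card (\<phi> ` A i) = card (A i)" "card (\<phi> ` B i) = card (B i)" if "i \<in> {1..m}" for i
    using sub[OF that] inj by (auto intro!: card_image inj_on_subset[OF inj])
  have "(\<Sum>i=1..m. 1 / real ((card (\<phi> ` A i) + card (\<phi> ` B i)) choose card (\<phi> ` A i))) \<le> 1"
  proof (rule skew_set_pairs_real)
    fix i assume i: "i \<in> {1..m}"
    show "finite (\<phi> ` A i) \<and> finite (\<phi> ` B i)" using finite_nonempty[OF i] by simp
    show "\<phi> ` A i \<inter> \<phi> ` B i = {}"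
      using inj_on_image_Int[OF inj sub[OF i]] disjoint[OF i] by simp
  next
    fix i j assume "1 \<le> i" "i < j" "j \<le> m"
    then show "\<phi> ` A i \<inter> \<phi> ` B j \<noteq> {}" using crossing by blast
  next
    show "mono_on {1..m} (\<lambda>i. card (\<phi> ` A i))"
      using card_A_increasing card(1) by (simp add: monotone_on_def)
    show "antimono_on {1..m} (\<lambda>i. card (\<phi> ` B i))"
      using card_B_decreasing card(2) by (simp add: monotone_on_def)
  qed
  then show ?thesis using card by simp
qed

end
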